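(* Let $\Gamma$ be a countable group. Assume that $N \lhd \Gamma$ is a normal subgroup contained in the FC-hypercentre of $\Gamma$, and let $\phi:\Gamma\to\Gamma/N$ be the quotient map. Let $\nu$ be a probability measure on $\Gamma/N$ whose support generates $\Gamma/N$. Then there exists a probability measure $\mu$ on $\Gamma$ such that $\phi_*\mu$ is a lazy version of $\nu$ and such that $\Gamma$ is $\mu$-Liouville if and only if $\Gamma/N$ is $\nu$-Liouville.
   Context: Measures are probability measures on countable (discrete) groups. For a probability measure $P$ on a countable group $G$ and a bounded function $f:G\to\mathbb{R}$, put $(f*P)(\gamma)=\sum_{y\in G} f(\gamma y^{-1})P(y)$. The function $f$ is $P$-harmonic if $f*P=f$. The group $G$ is $P$-Liouville if every bounded $P$-harmonic function on $G$ is constant. The push-forward of $\mu$ by $\phi$ is $\phi_*\mu(x)=\mu(\phi^{-1}(x))$. A measure $\mu'$ on a group $G$ is a lazy version of $\nu$ if there is $t\in[0,1)$ with $\mu' = t\delta_e+(1-t)\nu$, where $\delta_e$ is the Dirac mass at the identity. FC-hypercentre: the FC-centre $Z_{FC}(G)$ of a group $G$ is the subgroup of elements with finite conjugacy class. Put $Z_{FC}^0(\Gamma)=\{e\}$. For each ordinal $\lambda$, $Z_{FC}^{\lambda+1}(\Gamma)$ is the preimage in $\Gamma$ of $Z_{FC}(\Gamma/Z_{FC}^\lambda(\Gamma))$. For a limit ordinal $\beta$, $Z_{FC}^\beta(\Gamma)=\bigcup_{\lambda<\beta}Z_{FC}^\lambda(\Gamma)$. This sequence stabilises at some ordinal $\alpha$,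 and $Z_{FC}^\alpha(\Gamma)$ is the FC-hypercentre of $\Gamma$. *)

theory Defs
  imports "HOL-Algebra.Algebra" "HOL-Probability.Probability"
begin

section \<open>Harmonic functions and the Liouville property\<close>

text \<open>
  Groups are carrier-based, so a probability measure on \<open>G\<close> is a probability mass function \<open>P\<close>
  on the ambient type with \<open>set_pmf P \<subseteq> carrier G\<close>, and only the restriction to \<open>carrier G\<close> of a
  function \<open>f\<close> matters. For bounded \<open>f\<close> the sum below converges absolutely.
\<close>

definition convolution :: "('a, 'm) monoid_scheme \<Rightarrow> ('a \<Rightarrow> real) \<Rightarrow> 'a pmf \<Rightarrow> 'a \<Rightarrow> real" where
  "convolution G f P x = (\<Sum>\<^sub>\<infinity>y\<in>carrier G. f (x \<otimes>\<^bsub>G\<^esub> inv\<^bsub>G\<^esub> y) * pmf P y)"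

definition harmonic :: "('a, 'm) monoid_scheme \<Rightarrow> 'a pmf \<Rightarrow> ('a \<Rightarrow> real) \<Rightarrow> bool" where
  "harmonic G P f \<longleftrightarrow> (\<forall>x\<in>carrier G. convolution G f P x = f x)"

definition liouville :: "('a, 'm) monoid_scheme \<Rightarrow> 'a pmf \<Rightarrow> bool" where
  "liouville G P \<longleftrightarrow>
     (\<forall>f. bounded (f ` carrier G) \<longrightarrow> harmonic G P f \<longrightarrow> (\<exists>c. \<forall>x\<in>carrier G. f x = c))"

definition lazy_version :: "('a, 'm) monoid_scheme \<Rightarrow> 'a pmf \<Rightarrow> 'a pmf \<Rightarrow> bool" where
  "lazy_version G P Q \<longleftrightarrow>
     (\<exists>t. 0 \<le> t \<and> t < 1 \<and> (\<forall>x. pmf P x = t * pmf (return_pmf \<one>\<^bsub>G\<^esub>) x + (1 - t) * pmf Q x))"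


section \<open>The FC-hypercentre\<close>

definition FC_centre :: "('a, 'm) monoid_scheme \<Rightarrow> 'a set" where
  "FC_centre G =
     {x \<in> carrier G. finite {g \<otimes>\<^bsub>G\<^esub> x \<otimes>\<^bsub>G\<^esub> inv\<^bsub>G\<^esub> g | g. g \<in> carrier G}}"

definition FC_step :: "('a, 'm) monoid_scheme \<Rightarrow> 'a set \<Rightarrow> 'a set" where
  "FC_step G H = {x \<in> carrier G. H #>\<^bsub>G\<^esub> x \<in> FC_centre (G Mod H)}"

text \<open>
  Ordinals are represented by the elements of a well-order \<open>r\<close>: an element \<open>i\<close> stands for the order
  type of \<open>underS r i\<close>. It is zero if \<open>underS r i\<close> is empty, and it is the successor of \<open>j\<close> if
  \<open>underS r i = under r j\<close>.
\<close>

definition is_succ_of :: "'i rel \<Rightarrow> 'i \<Rightarrow> 'i \<Rightarrow> bool" where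
  "is_succ_of r i j \<longleftrightarrow> j \<in> underS r i \<and> underS r i = under r j"

definition FC_series :: "('a, 'm) monoid_scheme \<Rightarrow> 'i rel \<Rightarrow> 'i \<Rightarrow> 'a set" where
  "FC_series G r = wo_rel.worec r (\<lambda>Z i.
     if underS r i = {} then {\<one>\<^bsub>G\<^esub>}
     else if \<exists>j. is_succ_of r i j then FC_step G (Z (THE j. is_succ_of r i j))
     else (\<Union>j\<in>underS r i. Z j))"

text \<open>
  A cardinal well-order on \<open>'a set\<close> is longer than any strictly increasing chain of subsets of \<open>'a\<close>,
  so the series indexed by it reaches its stable value; see \<open>FC_series_stabilises\<close> and
  \<open>FC_series_subset_hypercentre\<close> below.
\<close>

definition FC_hypercentre :: "('a, 'm) monoid_scheme \<Rightarrow> 'a set" where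
  "FC_hypercentre G = (\<Union>i. FC_series G (card_of (UNIV :: 'a set set)) i)"


subsection \<open>The recursion equations of the series\<close>

lemma is_succ_of_unique:
  assumes "Well_order r" "is_succ_of r i j" "is_succ_of r i k"
  shows "j = k"
proof -
  have W: "wo_rel r" using assms(1) by (simp add: wo_rel_def)
  have "j \<in> under r k" "k \<in> under r j"
    using assms(2,3) unfolding is_succ_of_def by auto
  then show ?thesis
    using wo_rel.ANTISYM[OF W] unfolding under_def antisym_def by auto
qed

lemma FC_series_unfold:
  fixes G :: "('a, 'm) monoid_scheme" and r :: "'i rel"
  assumes "Well_order r"
  shows "FC_series G r i =
    (if underS r i = {} then {\<one>\<^bsub>G\<^esub>}
     else if \<exists>j. is_succ_of r i j then FC_step G (FC_series G r (THE j. is_succ_of r i j))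
     else (\<Union>j\<in>underS r i. FC_series G r j))"
proof -
  have W: "wo_rel r" using assms by (simp add: wo_rel_def)
  let ?H = "\<lambda>Z i. if underS r i = {} then {\<one>\<^bsub>G\<^esub>}
     else if \<exists>j. is_succ_of r i j then FC_step G (Z (THE j. is_succ_of r i j))
     else (\<Union>j\<in>underS r i. Z j)"
  have "wo_rel.adm_wo r ?H"
    unfolding wo_rel.adm_wo_def[OF W]
  proof (intro allI impI)
    fix f g :: "'i \<Rightarrow> 'a set" and x
    assume fg: "\<forall>y\<in>underS r x. f y = g y"
    have "f (THE j. is_succ_of r x j) = g (THE j. is_succ_of r x j)" if "is_succ_of r x j" for j
    proof -
      have "(THE j. is_succ_of r x j) = j"
        using that is_succ_of_unique[OF assms] by blast
      moreover have "j \<in> underS r x" using that unfolding is_succ_of_def by (rule conjunct1)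
      ultimately show ?thesis using fg by (simp only:)
    qed
    then show "?H f x = ?H g x" using fg by auto
  qed
  from wo_rel.worec_fixpoint[OF W this] show ?thesis
    unfolding FC_series_def by (rule fun_cong)
qed

lemma FC_series_zero:
  assumes "Well_order r" "underS r i = {}"
  shows "FC_series G r i = {\<one>\<^bsub>G\<^esub>}"
  using FC_series_unfold[OF assms(1), of G i] assms(2) by simp

lemma FC_series_succ:
  assumes "Well_order r" "is_succ_of r i j"
  shows "FC_series G r i = FC_step G (FC_series G r j)"
proof -
  have "(THE j. is_succ_of r i j) = j"
    using assms is_succ_of_unique[OF assms(1)] by blast
  moreover have "underS r i \<noteq> {}" using assms(2) by (auto simp: is_succ_of_def)
  ultimately show ?thesis
    using FC_series_unfold[OF assms(1), of G i] assms(2) by auto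
qed

lemma FC_series_limit:
  assumes "Well_order r" "underS r i \<noteq> {}" "\<nexists>j. is_succ_of r i j"
  shows "FC_series G r i = (\<Union>j\<in>underS r i. FC_series G r j)"
  using FC_series_unfold[OF assms(1), of G i] assms(2,3) by simp


subsection \<open>The series consists of normal subgroups and increases to the FC-hypercentre\<close>

lemma (in group) FC_centre_normal: "FC_centre G \<lhd> G"
proof -
  define C where "C x = {g \<otimes> x \<otimes> inv g | g. g \<in> carrier G}" for x
  have mem: "x \<in> FC_centre G \<longleftrightarrow> x \<in> carrier G \<and> finite (C x)" for x
    by (simp add: FC_centre_def C_def)
  have one: "\<one> \<in> FC_centre G"
  proof -
    have "C \<one> \<subseteq> {\<one>}" by (auto simp: C_def)
    then show ?thesis by (simp add: mem finite_subset)
  qed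
  have mult: "x \<otimes> y \<in> FC_centre G" if "x \<in> FC_centre G" "y \<in> FC_centre G" for x y
  proof -
    have xy: "x \<in> carrier G" "y \<in> carrier G" using that by (auto simp: mem)
    have "C (x \<otimes> y) \<subseteq> (\<lambda>(a, b). a \<otimes> b) ` (C x \<times> C y)"
    proof
      fix z assume "z \<in> C (x \<otimes> y)"
      then obtain g where g: "g \<in> carrier G" "z = g \<otimes> (x \<otimes> y) \<otimes> inv g"
        by (auto simp: C_def)
      have "z = (g \<otimes> x \<otimes> inv g) \<otimes> (g \<otimes> y \<otimes> inv g)"
        using g xy by (simp add: m_assoc inv_solve_left)
      then show "z \<in> (\<lambda>(a, b). a \<otimes> b) ` (C x \<times> C y)"
        using g(1) by (force simp: C_def)
    qed
    moreover have "finite (C x \<times> C y)" using that by (simp add: mem)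
    ultimately show ?thesis using xy by (simp add: mem finite_surj)
  qed
  have inv: "inv x \<in> FC_centre G" if "x \<in> FC_centre G" for x
  proof -
    have x: "x \<in> carrier G" using that by (simp add: mem)
    have "C (inv x) \<subseteq> m_inv G ` C x"
    proof
      fix z assume "z \<in> C (inv x)"
      then obtain g where g: "g \<in> carrier G" "z = g \<otimes> inv x \<otimes> inv g"
        by (auto simp: C_def)
      have "z = inv (g \<otimes> x \<otimes> inv g)"
        using g x by (simp add: inv_mult_group m_assoc)
      then show "z \<in> m_inv G ` C x" using g(1) by (auto simp: C_def)
    qed
    then show ?thesis using that x by (simp add: mem finite_surj)
  qed
  have conj: "h \<otimes> x \<otimes> inv h \<in> FC_centre G" if "x \<in> FC_centre G" "h \<in> carrier G" for x h
  proof -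
    have x: "x \<in> carrier G" using that by (simp add: mem)
    have "C (h \<otimes> x \<otimes> inv h) \<subseteq> C x"
    proof
      fix z assume "z \<in> C (h \<otimes> x \<otimes> inv h)"
      then obtain g where g: "g \<in> carrier G" "z = g \<otimes> (h \<otimes> x \<otimes> inv h) \<otimes> inv g"
        by (auto simp: C_def)
      have "z = (g \<otimes> h) \<otimes> x \<otimes> inv (g \<otimes> h)"
        using g x that(2) by (simp add: inv_mult_group m_assoc)
      then show "z \<in> C x" using g(1) that(2) by (auto simp: C_def)
    qed
    then show ?thesis using that x by (auto simp: mem finite_subset)
  qed
  have "subgroup (FC_centre G) G"
    by (rule subgroupI) (use one mult inv mem in auto)
  then show ?thesis using conj by (simp add: normal_inv_iff)
qed

lemma FC_step_normal:
  fixes G (structure)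
  assumes "H \<lhd> G"
  shows "FC_step G H \<lhd> G" and "H \<subseteq> FC_step G H"
proof -
  interpret normal H G by fact
  note G_closed = group.inv_closed[OF is_group] monoid.m_closed[OF group.is_monoid[OF is_group]]
  let ?Q = "G Mod H"
  interpret Q: group ?Q by (rule factorgroup_is_group)
  interpret Z: normal "FC_centre ?Q" ?Q by (rule Q.FC_centre_normal)
  interpret \<phi>: group_hom G ?Q "(#>) H"
    by unfold_locales (rule r_coset_hom_Mod)
  have mem: "x \<in> FC_step G H \<longleftrightarrow> x \<in> carrier G \<and> H #> x \<in> FC_centre ?Q" for x
    by (simp add: FC_step_def)
  show sub: "H \<subseteq> FC_step G H"
  proof
    fix x assume "x \<in> H"
    then have "x \<in> carrier G" "H #> x = \<one>\<^bsub>?Q\<^esub>"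
      using subset by (auto simp: rcos_const FactGroup_def is_group)
    then show "x \<in> FC_step G H" using Z.one_closed by (simp only: mem)
  qed
  have "subgroup (FC_step G H) G"
  proof (rule subgroupI)
    show "FC_step G H \<subseteq> carrier G" by (auto simp: mem)
    show "FC_step G H \<noteq> {}" 
      by (rule ex_in_conv[THEN iffD1, OF exI,
            OF subsetD[OF sub subgroup.one_closed[OF normal_imp_subgroup[OF assms]]]])
    show "inv a \<in> FC_step G H" if "a \<in> FC_step G H" for a
      using that Z.m_inv_closed[of "H #> a"] \<phi>.hom_inv[of a] G_closed(1)[of a]
      unfolding mem by (simp only: simp_thms)
    show "a \<otimes> b \<in> FC_step G H" if "a \<in> FC_step G H" "b \<in> FC_step G H" for a b
      using that Z.m_closed[of "H #> a" "H #> b"] \<phi>.hom_mult[of a b] G_closed(2)[of a b]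
      unfolding mem by (simp only: simp_thms)
  qed
  moreover have "h \<otimes> x \<otimes> inv h \<in> FC_step G H" if "x \<in> FC_step G H" "h \<in> carrier G" for x h
  proof -
    have x: "x \<in> carrier G" "H #> x \<in> FC_centre ?Q" using that by (simp_all only: mem)
    have "(H #> h) \<otimes>\<^bsub>?Q\<^esub> (H #> x) \<otimes>\<^bsub>?Q\<^esub> inv\<^bsub>?Q\<^esub> (H #> h) \<in> FC_centre ?Q"
      by (rule Z.inv_op_closed2[OF \<phi>.hom_closed[OF that(2)] x(2)])
    then have "H #> (h \<otimes> x \<otimes> inv h) \<in> FC_centre ?Q"
      using that(2) x(1) by (simp only: \<phi>.hom_mult \<phi>.hom_inv G_closed)
    then show ?thesis using that(2) x(1) by (simp only: mem G_closed)
  qed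
  ultimately show "FC_step G H \<lhd> G" by (simp add: normal_inv_iff)
qed

lemma FC_step_mono:
  assumes "H \<lhd> G" "K \<lhd> G" "H \<subseteq> K"
  shows "FC_step G H \<subseteq> FC_step G K"
proof
  fix x assume x: "x \<in> FC_step G H"
  interpret H: normal H G by fact
  interpret K: normal K G by fact
  have conj: "{g \<otimes>\<^bsub>G Mod L\<^esub> (L #>\<^bsub>G\<^esub> x) \<otimes>\<^bsub>G Mod L\<^esub> inv\<^bsub>G Mod L\<^esub> g | g. g \<in> carrier (G Mod L)} =
      (\<lambda>g. L #>\<^bsub>G\<^esub> (g \<otimes>\<^bsub>G\<^esub> x \<otimes>\<^bsub>G\<^esub> inv\<^bsub>G\<^esub> g)) ` carrier G" (is "?A = ?B")
    if L: "L \<lhd> G" and x: "x \<in> carrier G" for L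
  proof -
    interpret L: normal L G by fact
    interpret Q: group "G Mod L" by (rule L.factorgroup_is_group)
    interpret \<phi>: group_hom G "G Mod L" "(#>\<^bsub>G\<^esub>) L"
      by unfold_locales (rule L.r_coset_hom_Mod)
    have "carrier (G Mod L) = (#>\<^bsub>G\<^esub>) L ` carrier G"
      by (auto simp: FactGroup_def RCOSETS_def)
    then have "?A = (\<lambda>g. (L #>\<^bsub>G\<^esub> g) \<otimes>\<^bsub>G Mod L\<^esub> (L #>\<^bsub>G\<^esub> x) \<otimes>\<^bsub>G Mod L\<^esub> inv\<^bsub>G Mod L\<^esub> (L #>\<^bsub>G\<^esub> g)) ` carrier G"
      by auto
    also have "\<dots> = ?B"
      using x by (intro image_cong refl) (simp del: mult_FactGroup)
    finally show ?thesis .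
  qed
  have xG: "x \<in> carrier G" using x by (simp add: FC_step_def)
  have "K #>\<^bsub>G\<^esub> y = K <#>\<^bsub>G\<^esub> (H #>\<^bsub>G\<^esub> y)" if "y \<in> carrier G" for y
  proof -
    have "K <#>\<^bsub>G\<^esub> H = K"
    proof
      show "K <#>\<^bsub>G\<^esub> H \<subseteq> K" using assms(3) by (auto simp: set_mult_def)
      show "K \<subseteq> K <#>\<^bsub>G\<^esub> H"
      proof
        fix k assume "k \<in> K"
        moreover from this have "k \<otimes>\<^bsub>G\<^esub> \<one>\<^bsub>G\<^esub> = k"
          using K.subset by auto
        ultimately show "k \<in> K <#>\<^bsub>G\<^esub> H"
          unfolding set_mult_def using H.one_closed by fastforce
      qed
    qed
    then show ?thesis
      using that H.setmult_rcos_assoc[OF K.subset H.subset] by simp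
  qed
  then have "(\<lambda>g. K #>\<^bsub>G\<^esub> (g \<otimes>\<^bsub>G\<^esub> x \<otimes>\<^bsub>G\<^esub> inv\<^bsub>G\<^esub> g)) ` carrier G =
      (\<lambda>A. K <#>\<^bsub>G\<^esub> A) ` (\<lambda>g. H #>\<^bsub>G\<^esub> (g \<otimes>\<^bsub>G\<^esub> x \<otimes>\<^bsub>G\<^esub> inv\<^bsub>G\<^esub> g)) ` carrier G"
    using xG by (auto simp: image_image)
  moreover have "finite ((\<lambda>g. H #>\<^bsub>G\<^esub> (g \<otimes>\<^bsub>G\<^esub> x \<otimes>\<^bsub>G\<^esub> inv\<^bsub>G\<^esub> g)) ` carrier G)"
    using x conj[OF assms(1) xG] by (simp add: FC_step_def FC_centre_def)
  ultimately have "finite ((\<lambda>g. K #>\<^bsub>G\<^esub> (g \<otimes>\<^bsub>G\<^esub> x \<otimes>\<^bsub>G\<^esub> inv\<^bsub>G\<^esub> g)) ` carrier G)"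
    by simp
  moreover have "K #>\<^bsub>G\<^esub> x \<in> carrier (G Mod K)"
    using xG by (auto simp: FactGroup_def RCOSETS_def)
  ultimately show "x \<in> FC_step G K"
    using conj[OF assms(2) xG] xG by (simp add: FC_step_def FC_centre_def)
qed

lemma FC_series_normal_mono:
  assumes "group G" "Well_order r" "i \<in> Field r"
  shows "FC_series G r i \<lhd> G \<and> (\<forall>j\<in>underS r i. FC_step G (FC_series G r j) \<subseteq> FC_series G r i)"
proof -
  have W: "wo_rel r" using assms(2) by (simp add: wo_rel_def)
  interpret G: group G by fact
  let ?Z = "FC_series G r"
  have "i \<in> Field r \<longrightarrow>
    ?Z i \<lhd> G \<and> (\<forall>j\<in>underS r i. FC_step G (?Z j) \<subseteq> ?Z i)"
  proof (induction i rule: wo_rel.well_order_induct[OF W])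
    case (1 i)
    have fld: "j \<in> Field r" if "j \<in> underS r i" for j
      using that by (auto simp: underS_def Field_def)
    have IH1: "?Z j \<lhd> G" if "j \<in> underS r i" for j
      using 1 that fld[OF that] by (auto simp: underS_def)
    have IH2: "FC_step G (?Z k) \<subseteq> ?Z j" if "j \<in> underS r i" "k \<in> underS r j" for j k
      using 1 that(2) fld[OF that(1)] that(1) by (auto simp: underS_def)
    consider (zero) "underS r i = {}" | (succ) j where "is_succ_of r i j"
      | (limit) "underS r i \<noteq> {}" "\<nexists>j. is_succ_of r i j" by blast
    then show ?case
    proof cases
      case zero
      then show ?thesis
        using FC_series_zero[OF assms(2) zero, of G] G.one_is_normal by simp
    next
      case (succ j)
      note eq = FC_series_succ[OF assms(2) succ, of G]
      have j: "j \<in> underS r i" and ij: "underS r i = under r j"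
        using succ by (auto simp: is_succ_of_def)
      have "FC_step G (?Z k) \<subseteq> ?Z i" if "k \<in> underS r i" for k
      proof (cases "k = j")
        case False
        then have "k \<in> underS r j" using that ij by (auto simp: under_def underS_def)
        then have "FC_step G (?Z k) \<subseteq> ?Z j" using IH2 j by blast
        also have "\<dots> \<subseteq> ?Z i" unfolding eq by (rule FC_step_normal(2)[OF IH1[OF j]])
        finally show ?thesis .
      qed (simp add: eq)
      then show ?thesis using FC_step_normal(1)[OF IH1[OF j]] eq by auto
    next
      case limit
      note eq = FC_series_limit[OF assms(2) limit, of G]
      have step: "FC_step G (?Z k) \<subseteq> ?Z i" if k: "k \<in> underS r i" for k
      proof -
        have "\<not> is_succ_of r i k" using limit by blast
        moreover have "under r k \<subseteq> underS r i"
          using k wo_rel.TRANS[OF W] wo_rel.ANTISYM[OF W] unfolding under_def underS_def trans_def antisym_def by blast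
        ultimately obtain l where l: "l \<in> underS r i" "l \<notin> under r k"
          using k by (auto simp: is_succ_of_def)
        then have "k \<in> underS r l"
          using wo_rel.TOTALS[OF W] fld[OF k] fld[OF l(1)] wo_rel.REFL[OF W]
          unfolding under_def underS_def refl_on_def by blast
        then have "FC_step G (?Z k) \<subseteq> ?Z l" using IH2 l(1) by blast
        then show ?thesis unfolding eq using l(1) by blast
      qed
      have chain: "?Z j \<subseteq> ?Z k \<or> ?Z k \<subseteq> ?Z j" if "j \<in> underS r i" "k \<in> underS r i" for j k
      proof -
        have "j = k \<or> j \<in> underS r k \<or> k \<in> underS r j"
          using wo_rel.TOTALS[OF W] fld[OF that(1)] fld[OF that(2)] by (auto simp: underS_def)
        then show ?thesis
          using IH2[OF that(1), of k] IH2[OF that(2), of j] FC_step_normal(2)[OF IH1[OF that(1)]]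
            FC_step_normal(2)[OF IH1[OF that(2)]] by blast
      qed
      have sub: "subgroup (?Z j) G" if "j \<in> underS r i" for j
        using IH1[OF that] by (rule normal_imp_subgroup)
      have "subgroup (?Z i) G"
      proof (rule G.subgroupI)
        show "?Z i \<subseteq> carrier G" unfolding eq using subgroup.subset[OF sub] by blast
        show "?Z i \<noteq> {}" unfolding eq using limit(1) subgroup.one_closed[OF sub] by blast
        show "inv\<^bsub>G\<^esub> a \<in> ?Z i" if a: "a \<in> ?Z i" for a
        proof -
          obtain j where j: "j \<in> underS r i" "a \<in> ?Z j" using a unfolding eq by blast
          then show ?thesis unfolding eq using subgroup.m_inv_closed[OF sub[OF j(1)] j(2)] by blast
        qed
        show "a \<otimes>\<^bsub>G\<^esub> b \<in> ?Z i" if ab: "a \<in> ?Z i" "b \<in> ?Z i" for a b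
        proof -
          obtain j k where jk: "j \<in> underS r i" "a \<in> ?Z j" "k \<in> underS r i" "b \<in> ?Z k"
            using ab unfolding eq by blast
          then obtain l where l: "l \<in> underS r i" "a \<in> ?Z l" "b \<in> ?Z l"
            using chain[OF jk(1,3)] by blast
          show ?thesis unfolding eq using subgroup.m_closed[OF sub[OF l(1)] l(2,3)] l(1) by blast
        qed
      qed
      moreover have "h \<otimes>\<^bsub>G\<^esub> x \<otimes>\<^bsub>G\<^esub> inv\<^bsub>G\<^esub> h \<in> ?Z i" if "x \<in> ?Z i" "h \<in> carrier G" for x h
        using that IH1 unfolding eq by (auto simp: G.normal_inv_iff)
      ultimately show ?thesis using step by (auto simp: G.normal_inv_iff)
    qed
  qed
  then show ?thesis using assms(3) by blast
qed

theorem FC_series_stabilises: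
  fixes G :: "('a, 'm) monoid_scheme"
  assumes "group G"
  shows "\<exists>i. FC_series G (card_of (UNIV :: 'a set set)) i = FC_hypercentre G"
    and "FC_hypercentre G \<lhd> G" and "FC_step G (FC_hypercentre G) = FC_hypercentre G"
proof -
  define r where "r = card_of (UNIV :: 'a set set)"
  let ?Z = "FC_series G r"
  have wo: "Well_order r" and fld: "Field r = UNIV"
    by (simp_all add: r_def card_of_Well_order)
  have W: "wo_rel r" using wo by (simp add: wo_rel_def)
  note nm = FC_series_normal_mono[OF assms wo, unfolded fld, OF UNIV_I]
  have "\<exists>i. FC_step G (?Z i) = ?Z i"
  proof (rule ccontr)
    assume "\<nexists>i. FC_step G (?Z i) = ?Z i"
    then have "\<forall>i. \<exists>x. x \<in> FC_step G (?Z i) - ?Z i"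
      using FC_step_normal(2) nm by blast
    then obtain x where x: "\<And>i. x i \<in> FC_step G (?Z i) - ?Z i" by metis
    have "x i \<noteq> x j" if "i \<in> underS r j" for i j
      using x[of i] x[of j] nm[of j] that by (metis DiffD1 DiffD2 subsetD)
    then have "i = j" if "x i = x j" for i j
      using that wo_rel.TOTALS[OF W] unfolding fld underS_def by (metis (mono_tags, lifting) UNIV_I mem_Collect_eq)
    then have "inj x" by (rule injI)
    then show False by (metis Cantors_theorem Pow_UNIV inj_imp_surj_inv surj_def image_eqI UNIV_I)
  qed
  then obtain a where a: "FC_step G (?Z a) = ?Z a" by blast
  have le: "?Z i \<subseteq> ?Z a" for i
  proof (induction i rule: wo_rel.well_order_induct[OF W])
    case (1 i)
    consider (zero) "underS r i = {}" | (succ) j where "is_succ_of r i j"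
      | (limit) "underS r i \<noteq> {}" "\<nexists>j. is_succ_of r i j" by blast
    then show ?case
    proof cases
      case zero
      then show ?thesis
        using FC_series_zero[OF wo, of i G] subgroup.one_closed[OF normal_imp_subgroup] nm[of a] by auto
    next
      case (succ j)
      then have "?Z j \<subseteq> ?Z a" using 1 by (auto simp: is_succ_of_def underS_def)
      then have "FC_step G (?Z j) \<subseteq> FC_step G (?Z a)"
        using FC_step_mono nm by blast
      then show ?thesis using FC_series_succ[OF wo succ, of G] a by simp
    next
      case limit
      then show ?thesis
        using FC_series_limit[OF wo limit, of G] 1 by (auto simp: underS_def)
    qed
  qed
  then have eq: "FC_hypercentre G = ?Z a"
    unfolding FC_hypercentre_def r_def[symmetric] by blast
  then show "\<exists>i. FC_series G (card_of (UNIV :: 'a set set)) i = FC_hypercentre G"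
    unfolding r_def by blast
  show "FC_hypercentre G \<lhd> G" "FC_step G (FC_hypercentre G) = FC_hypercentre G"
    using eq a nm by auto
qed

theorem FC_series_subset_hypercentre:
  assumes "group G" "Well_order r" "i \<in> Field r"
  shows "FC_series G r i \<subseteq> FC_hypercentre G"
proof -
  have W: "wo_rel r" using assms(2) by (simp add: wo_rel_def)
  note st = FC_series_stabilises[OF assms(1)]
  have "i \<in> Field r \<longrightarrow> FC_series G r i \<subseteq> FC_hypercentre G"
  proof (induction i rule: wo_rel.well_order_induct[OF W])
    case (1 i)
    consider (zero) "underS r i = {}" | (succ) j where "is_succ_of r i j"
      | (limit) "underS r i \<noteq> {}" "\<nexists>j. is_succ_of r i j" by blast
    then show ?case
    proof cases
      case zero
      then show ?thesis
        using FC_series_zero[OF assms(2), of i G] subgroup.one_closed[OF normal_imp_subgroup[OF st(2)]]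
        by auto
    next
      case (succ j)
      then have j: "j \<in> Field r" "FC_series G r j \<subseteq> FC_hypercentre G"
        using 1 by (auto simp: is_succ_of_def underS_def Field_def)
      then have "FC_step G (FC_series G r j) \<subseteq> FC_step G (FC_hypercentre G)"
        using FC_step_mono st(2) FC_series_normal_mono[OF assms(1,2)] by blast
      then show ?thesis using FC_series_succ[OF assms(2) succ, of G] st(3) by simp
    next
      case limit
      have "FC_series G r j \<subseteq> FC_hypercentre G" if "j \<in> underS r i" for j
        using 1 that by (auto simp: underS_def Field_def)
      then show ?thesis
        unfolding FC_series_limit[OF assms(2) limit] by blast
    qed
  qed
  then show ?thesis using assms(3) by blast
qed

end

theory Submission
  imports Defs
begin

text \<open>
  The measure is \<open>\<mu> = 1/2 \<eta> + 1/2 \<theta>\<close>, where \<open>\<eta>\<close> is any probability measure whose support is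
  the whole of \<open>N\<close> and \<open>\<theta>\<close> is any lift of \<open>\<nu>\<close> to \<open>\<Gamma>\<close> (\<open>lazy_lift_exists\<close>). The push-forward of \<open>\<eta>\<close>
  is the Dirac mass at the identity, so the push-forward of \<open>\<mu>\<close> is a lazy version of \<open>\<nu>\<close>, and a lazy
  version has the same bounded harmonic functions as the original measure. It remains to compare \<open>\<Gamma>\<close>
  and \<open>\<Gamma>/N\<close>: harmonic functions on \<open>\<Gamma>/N\<close> pull back to \<open>\<Gamma>\<close>, and bounded harmonic functions on \<open>\<Gamma>\<close>
  descend to \<open>\<Gamma>/N\<close> as soon as they are \<open>N\<close>-invariant (\<open>liouville_map_pmf_iff\<close>). So everything
  reduces to the claim that every bounded \<open>\<mu>\<close>-harmonic \<open>f\<close> satisfies \<open>f (z x) = f x\<close> for \<open>z \<in> N\<close>.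

  The claim is proved along the FC-series, and the heart of it is a form of the Choquet--Deny
  argument (\<open>bounded_harmonic_le_translate\<close>). Suppose first that \<open>z\<close> is central and \<open>\<mu> z > 0\<close>. The
  function \<open>g x = f x - f (z x)\<close> is harmonic. Where \<open>g\<close> is close to its supremum \<open>D\<close>, so is it at
  \<open>x z\<^sup>-\<^sup>1\<close>, because \<open>g x\<close> is an average that gives this point the weight \<open>\<mu> z\<close>; iterating, \<open>g\<close> is
  close to \<open>D\<close> at \<open>x z\<^sup>-\<^sup>j\<close> for all \<open>j\<close> up to a prescribed bound. But the sum of the values
  \<open>g (x z\<^sup>-\<^sup>j)\<close> telescopes to a difference of two values of \<open>f\<close>, which is bounded. Hence \<open>D \<le> 0\<close>.

  If \<open>z\<close> only has finitely many conjugates, then \<open>z x = x c\<close> where the conjugate \<open>c\<close> depends on \<open>x\<close>,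
  and the same argument works with steps \<open>c\<^sup>-\<^sup>1\<close>: the conjugates lie in \<open>N\<close>, so they all have positive
  mass, and as there are finitely many of them, the estimates are uniform in \<open>x\<close>. At a successor
  stage of the FC-series the conjugates of \<open>z\<close> are finite in number only modulo the previous term
  \<open>H\<close>. Two conjugates in the same coset of \<open>H\<close> differ by an element of \<open>N \<inter> H\<close>, under which \<open>f\<close> is
  already known to be invariant (\<open>FC_step_conjugates\<close>), so this is harmless.
\<close>


section \<open>Convolution with a probability measure\<close>

lemma summable_on_bounded_mult_pmf:
  fixes h :: "'a \<Rightarrow> real"
  assumes "\<And>y. y \<in> A \<Longrightarrow> \<bar>h y\<bar> \<le> B"
  shows "(\<lambda>y. h y * pmf P y) summable_on A"
proof -
  have "pmf P summable_on UNIV"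
    using abs_summable_equivalent[of "pmf P" UNIV, THEN iffD2, OF pmf_abs_summable] by simp
  then have "pmf P summable_on A"
    by (rule summable_on_subset_banach) simp
  then have *: "(\<lambda>y. B * pmf P y) summable_on A"
    by (rule summable_on_cmult_right)
  have "(\<lambda>y. norm (h y * pmf P y)) summable_on A"
    by (rule summable_on_comparison_test[OF *])
      (use assms in \<open>auto simp: abs_mult intro!: mult_right_mono\<close>)
  then show ?thesis by (rule abs_summable_summable)
qed

text \<open>
  Expectations do not see the values of \<open>h\<close> off the support, so \<open>h\<close> may be unbounded, or not even
  meaningful, outside \<open>A\<close>; in the application \<open>A\<close> is the carrier of a group.
\<close>

lemma expectation_eq_infsum_pmf:
  fixes h :: "'a \<Rightarrow> real"
  assumes "set_pmf P \<subseteq> A" and "\<And>y. y \<in> A \<Longrightarrow> \<bar>h y\<bar> \<le> B"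
  shows "measure_pmf.expectation P h = (\<Sum>\<^sub>\<infinity>y\<in>A. h y * pmf P y)"
proof -
  define k where "k y = (if y \<in> A then h y else 0)" for y
  have "(\<lambda>y. \<bar>k y\<bar> * pmf P y) summable_on UNIV"
    by (rule summable_on_bounded_mult_pmf[where B = "max B 0"])
      (use assms(2) in \<open>auto simp: k_def le_max_iff_disj\<close>)
  then have "(\<lambda>y. norm (pmf P y * k y)) summable_on UNIV"
    by (simp add: abs_mult mult.commute)
  note abs = abs_summable_equivalent[THEN iffD1, OF this]
  have "measure_pmf.expectation P h = measure_pmf.expectation P k"
    using assms(1) by (intro integral_cong_AE) (auto simp: AE_measure_pmf_iff k_def)
  also have "\<dots> = (\<Sum>\<^sub>\<infinity>y. pmf P y * k y)"
    by (simp only: pmf_expectation_eq_infsetsum infsetsum_infsum[OF abs])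
  also have "\<dots> = (\<Sum>\<^sub>\<infinity>y\<in>A. h y * pmf P y)"
    by (rule infsum_cong_neutral) (auto simp: k_def)
  finally show ?thesis .
qed

context group
begin

lemma convolution_summable:
  assumes "bounded (f ` carrier G)" "x \<in> carrier G"
  shows "(\<lambda>y. f (x \<otimes> inv y) * pmf P y) summable_on carrier G"
proof -
  obtain B where "\<And>y. y \<in> carrier G \<Longrightarrow> \<bar>f y\<bar> \<le> B"
    using assms(1) by (auto simp: bounded_iff)
  then show ?thesis
    by (intro summable_on_bounded_mult_pmf[where B = B]) (use assms(2) in auto)
qed

lemma convolution_eq_expectation:
  assumes "set_pmf P \<subseteq> carrier G" "bounded (f ` carrier G)" "x \<in> carrier G"
  shows "convolution G f P x = measure_pmf.expectation P (\<lambda>y. f (x \<otimes> inv y))"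
proof -
  obtain B where "\<And>y. y \<in> carrier G \<Longrightarrow> \<bar>f y\<bar> \<le> B"
    using assms(2) by (auto simp: bounded_iff)
  then show ?thesis
    unfolding convolution_def
    by (intro expectation_eq_infsum_pmf[symmetric, where B = B]) (use assms in auto)
qed

lemma harmonic_cong:
  assumes "\<And>x. x \<in> carrier G \<Longrightarrow> f x = g x"
  shows "harmonic G P f \<longleftrightarrow> harmonic G P g"
  unfolding harmonic_def convolution_def
  by (intro ball_cong refl arg_cong2[where f = "(=)"] infsum_cong) (simp_all add: assms)

lemma harmonic_const:
  assumes "set_pmf P \<subseteq> carrier G"
  shows "harmonic G P (\<lambda>_. c)"
  using assms by (auto simp: harmonic_def convolution_eq_expectation image_constant_conv)

lemma harmonic_diff:
  assumes "bounded (f ` carrier G)" "harmonic G P f" "bounded (g ` carrier G)" "harmonic G P g"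
  shows "harmonic G P (\<lambda>x. f x - g x)"
  unfolding harmonic_def
proof
  fix x assume x: "x \<in> carrier G"
  let ?s = "\<lambda>f y. f (x \<otimes> inv y) * pmf P y"
  have "convolution G (\<lambda>x. f x - g x) P x = (\<Sum>\<^sub>\<infinity>y\<in>carrier G. ?s f y + - ?s g y)"
    unfolding convolution_def by (rule infsum_cong) (simp add: left_diff_distrib)
  also have "\<dots> = infsum (?s f) (carrier G) + (\<Sum>\<^sub>\<infinity>y\<in>carrier G. - ?s g y)"
    by (rule infsum_add) (simp_all only: summable_on_uminus convolution_summable assms x)
  also have "\<dots> = convolution G f P x - convolution G g P x"
    by (simp only: infsum_uminus convolution_def diff_conv_add_uminus)
  finally have "convolution G (\<lambda>x. f x - g x) P x = convolution G f P x - convolution G g P x" .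
  then show "convolution G (\<lambda>x. f x - g x) P x = f x - g x"
    using assms x by (simp add: harmonic_def)
qed

lemma bounded_left_translate:
  assumes "bounded (f ` carrier G)" "z \<in> carrier G"
  shows "bounded ((\<lambda>x. f (z \<otimes> x)) ` carrier G)"
  by (rule bounded_subset[OF assms(1)]) (use assms(2) in auto)

lemma harmonic_left_translate:
  assumes "harmonic G P f" "z \<in> carrier G"
  shows "harmonic G P (\<lambda>x. f (z \<otimes> x))"
  unfolding harmonic_def
proof
  fix x assume x: "x \<in> carrier G"
  have "convolution G (\<lambda>x. f (z \<otimes> x)) P x = convolution G f P (z \<otimes> x)"
    unfolding convolution_def by (rule infsum_cong) (use assms(2) x in \<open>simp add: m_assoc\<close>)
  then show "convolution G (\<lambda>x. f (z \<otimes> x)) P x = f (z \<otimes> x)"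
    using assms x by (simp add: harmonic_def)
qed


section \<open>Invariance of bounded harmonic functions\<close>

text \<open>
  A Harnack inequality: \<open>h x\<close> is the average of the nonnegative values \<open>h (x y\<^sup>-\<^sup>1)\<close>, so it is at least
  the single term \<open>y = c\<close>.
\<close>

lemma nonneg_harmonic_step:
  assumes "bounded (h ` carrier G)" "harmonic G P h" "\<And>y. y \<in> carrier G \<Longrightarrow> 0 \<le> h y"
    and "x \<in> carrier G" "c \<in> carrier G"
  shows "pmf P c * h (x \<otimes> inv c) \<le> h x"
proof -
  have "(\<Sum>y\<in>{c}. h (x \<otimes> inv y) * pmf P y) \<le> convolution G h P x"
    unfolding convolution_def
    by (rule finite_sum_le_infsum) (use assms in \<open>auto intro: convolution_summable\<close>)
  also have "\<dots> = h x" using assms(2,4) by (simp add: harmonic_def)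
  finally show ?thesis by (simp add: mult.commute)
qed

lemma nonneg_harmonic_steps:
  fixes j :: nat
  assumes "bounded (h ` carrier G)" "harmonic G P h" "\<And>y. y \<in> carrier G \<Longrightarrow> 0 \<le> h y"
    and "x \<in> carrier G" "c \<in> carrier G"
  shows "pmf P c ^ j * h (x \<otimes> inv c [^] j) \<le> h x"
proof (induction j)
  case 0
  show ?case using assms(4) by simp
next
  case (Suc j)
  have "pmf P c * h (x \<otimes> inv c [^] Suc j) \<le> h (x \<otimes> inv c [^] j)"
    using nonneg_harmonic_step[OF assms(1-3), of "x \<otimes> inv c [^] j" c] assms(4,5)
    by (simp add: m_assoc)
  then have "pmf P c ^ j * (pmf P c * h (x \<otimes> inv c [^] Suc j)) \<le> pmf P c ^ j * h (x \<otimes> inv c [^] j)"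
    by (rule mult_left_mono) simp
  with Suc show ?case by (simp add: mult_ac)
qed

text \<open>
  The telescoping argument from the introduction. The set \<open>K\<close> consists of translations under which
  \<open>f\<close> is already known to be invariant, and \<open>R\<close> contains the elements \<open>c\<close> to be used as steps; the
  hypothesis \<open>swap\<close> says that left translation by \<open>z\<close> amounts to right translation by some \<open>c \<in> R\<close>,
  as far as functions invariant under \<open>K\<close> are concerned. Finiteness of \<open>R\<close> gives one lower bound \<open>p\<close>
  for the masses of all possible steps, so that the number \<open>J\<close> of steps can be fixed before the
  starting point \<open>y\<close>, on which \<open>c\<close> depends.
\<close>

lemma bounded_harmonic_le_translate:
  assumes P: "set_pmf P \<subseteq> carrier G"
    and bdd: "bounded (f ` carrier G)" and harm: "harmonic G P f"
    and z: "z \<in> carrier G" and K: "K \<subseteq> carrier G"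
    and inv: "\<And>k y. k \<in> K \<Longrightarrow> y \<in> carrier G \<Longrightarrow> f (k \<otimes> y) = f y"
    and R: "finite R" "R \<subseteq> set_pmf P"
    and swap: "\<And>x. x \<in> carrier G \<Longrightarrow> \<exists>k\<in>K. \<exists>c\<in>R. z \<otimes> x = k \<otimes> x \<otimes> c"
    and x: "x \<in> carrier G"
  shows "f x \<le> f (z \<otimes> x)"
proof (rule ccontr)
  assume neg: "\<not> f x \<le> f (z \<otimes> x)"
  define g where "g x = f x - f (z \<otimes> x)" for x
  define D where "D = (SUP x\<in>carrier G. g x)"
  obtain B where B: "\<And>y. y \<in> carrier G \<Longrightarrow> \<bar>f y\<bar> \<le> B"
    using bdd by (auto simp: bounded_iff)
  have g_bdd: "bounded (g ` carrier G)"
    unfolding g_def by (intro bounded_minus_comp bdd bounded_left_translate z)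
  then have bdd_above: "bdd_above (g ` carrier G)" by (rule bounded_imp_bdd_above)
  have g_le: "g y \<le> D" if "y \<in> carrier G" for y
    unfolding D_def by (rule cSUP_upper[OF that bdd_above])
  have D: "0 < D" using neg g_le[OF x] by (simp add: g_def)
  define h where "h x = D - g x" for x
  have h_bdd: "bounded (h ` carrier G)"
    unfolding h_def by (intro bounded_minus_comp g_bdd) (simp add: image_constant_conv)
  have h_harm: "harmonic G P h"
    unfolding h_def
    by (intro harmonic_diff harmonic_const P g_bdd)
      (auto simp: g_def image_constant_conv intro!: harmonic_diff bdd harm
        bounded_left_translate harmonic_left_translate z)
  have h_nonneg: "0 \<le> h y" if "y \<in> carrier G" for y
    using g_le[OF that] by (simp add: h_def)
  define p where "p = Min (pmf P ` R)"
  have "R \<noteq> {}" using swap[OF x] by blast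
  then have p_mem: "p \<in> pmf P ` R" unfolding p_def using R(1) by (intro Min_in) auto
  have p_le: "p \<le> pmf P c" if "c \<in> R" for c
    unfolding p_def using R(1) that by simp
  have p: "0 < p" "p \<le> 1"
    using p_mem R(2) by (auto simp: pmf_le_1 set_pmf_iff pmf_pos)
  \<comment> \<open>\<open>J\<close> steps with increment above \<open>D / 2\<close> exceed the oscillation \<open>2 * B\<close> of \<open>f\<close>.\<close>
  obtain J :: nat where J: "2 * B / (D / 2) < real J" using reals_Archimedean2 by blast
  \<comment> \<open>Each of the \<open>J\<close> steps may enlarge the gap \<open>h = D - g\<close> by the factor \<open>1 / p\<close>, so a gap below
    \<open>p ^ J * (D / 2)\<close> at the start stays below \<open>D / 2\<close>.\<close>
  have "D - p ^ J * (D / 2) < D" using p D by simp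
  then obtain y where y: "y \<in> carrier G" "D - p ^ J * (D / 2) < g y"
    using less_cSUP_iff[OF _ bdd_above, of "D - p ^ J * (D / 2)"] x unfolding D_def by blast
  obtain k c where kc: "k \<in> K" "c \<in> R" "z \<otimes> y = k \<otimes> y \<otimes> c" using swap[OF y(1)] by blast
  have c: "c \<in> carrier G" and k: "k \<in> carrier G" using kc P R K by auto
  define w where "w j = y \<otimes> inv c [^] j" for j :: nat
  have w: "w j \<in> carrier G" for j using y c by (simp add: w_def)
  have large: "D / 2 < g (w j)" if "j \<le> J" for j
  proof -
    have pos: "0 < pmf P c ^ j" using p(1) p_le[OF kc(2)] by simp
    have "p ^ J \<le> p ^ j" using p that by (intro power_decreasing) auto
    also have "\<dots> \<le> pmf P c ^ j" using p p_le[OF kc(2)] by (intro power_mono) auto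
    finally have le: "p ^ J \<le> pmf P c ^ j" .
    have "pmf P c ^ j * h (w j) \<le> h y"
      unfolding w_def by (rule nonneg_harmonic_steps[OF h_bdd h_harm h_nonneg y(1) c])
    also have "\<dots> < p ^ J * (D / 2)" using y(2) by (simp add: h_def)
    also have "\<dots> \<le> pmf P c ^ j * (D / 2)" using le D by (intro mult_right_mono) auto
    finally have "h (w j) < D / 2" using pos by (simp only: mult_less_cancel_left_pos)
    then show ?thesis by (simp add: h_def)
  qed
  have telescope: "g (w (Suc j)) = f (w (Suc j)) - f (w j)" for j
  proof -
    have "inv c [^] Suc j = inv c \<otimes> inv c [^] j"
      using c by (intro nat_pow_Suc2) simp
    then have "z \<otimes> w (Suc j) = (z \<otimes> y) \<otimes> (inv c \<otimes> inv c [^] j)"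
      using z y c by (simp add: w_def m_assoc)
    also have "\<dots> = k \<otimes> y \<otimes> (c \<otimes> inv c) \<otimes> inv c [^] j"
      unfolding kc(3) using k y c by (simp only: m_assoc m_closed inv_closed nat_pow_closed)
    also have "\<dots> = k \<otimes> w j" using k y c by (simp add: w_def m_assoc)
    finally show ?thesis using inv[OF kc(1) w] by (simp add: g_def)
  qed
  have "real J * (D / 2) = (\<Sum>j<J. D / 2)" by simp
  also have "\<dots> \<le> (\<Sum>j<J. g (w (Suc j)))"
    using large by (intro sum_mono less_imp_le) auto
  also have "\<dots> = f (w J) - f (w 0)"
    unfolding telescope by (rule sum_lessThan_telescope)
  also have "\<dots> \<le> 2 * B" using B[OF w, of J] B[OF w, of 0] by linarith
  finally show False using J D by (simp add: field_simps)
qed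

text \<open>The reverse inequality is the same statement for \<open>- f\<close>.\<close>

lemma bounded_harmonic_eq_translate:
  assumes P: "set_pmf P \<subseteq> carrier G"
    and bdd: "bounded (f ` carrier G)" and harm: "harmonic G P f"
    and z: "z \<in> carrier G" and K: "K \<subseteq> carrier G"
    and inv: "\<And>k y. k \<in> K \<Longrightarrow> y \<in> carrier G \<Longrightarrow> f (k \<otimes> y) = f y"
    and R: "finite R" "R \<subseteq> set_pmf P"
    and swap: "\<And>x. x \<in> carrier G \<Longrightarrow> \<exists>k\<in>K. \<exists>c\<in>R. z \<otimes> x = k \<otimes> x \<otimes> c"
    and x: "x \<in> carrier G"
  shows "f (z \<otimes> x) = f x"
proof (rule antisym)
  have zero: "bounded ((\<lambda>_. 0 :: real) ` carrier G)" by (simp add: image_constant_conv)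
  have "0 - f x \<le> 0 - f (z \<otimes> x)"
    by (rule bounded_harmonic_le_translate[where f = "\<lambda>x. 0 - f x",
          OF P bounded_minus_comp[OF zero bdd] harmonic_diff[OF zero harmonic_const[OF P] bdd harm]
            z K _ R swap x]) (simp_all add: inv)
  then show "f (z \<otimes> x) \<le> f x" by simp
  show "f x \<le> f (z \<otimes> x)"
    by (rule bounded_harmonic_le_translate[OF P bdd harm z K inv R swap x])
qed

text \<open>
  This supplies the hypothesis \<open>swap\<close> of the telescoping argument with \<open>K = N \<inter> H\<close>. The conjugates
  \<open>x\<^sup>-\<^sup>1 z x\<close> meet only finitely many cosets of \<open>H\<close>; \<open>R\<close> consists of one conjugate from each. Taking
  conjugates as representatives puts \<open>R\<close> inside \<open>N\<close>. If \<open>c\<close> represents the coset of \<open>x\<^sup>-\<^sup>1 z x = h c\<close>,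
  then \<open>h\<close> is a quotient of two elements of \<open>N\<close>, and \<open>k = x h x\<^sup>-\<^sup>1\<close> lies in \<open>N \<inter> H\<close> by normality.
\<close>

lemma FC_step_conjugates:
  assumes H: "H \<lhd> G" and N: "N \<lhd> G" and z: "z \<in> N" "z \<in> FC_step G H"
  shows "\<exists>R. finite R \<and> R \<subseteq> N \<and>
    (\<forall>x\<in>carrier G. \<exists>k\<in>N \<inter> H. \<exists>c\<in>R. z \<otimes> x = k \<otimes> x \<otimes> c)"
proof -
  interpret H: normal H G by fact
  interpret N: normal N G by fact
  interpret Q: group "G Mod H" by (rule H.factorgroup_is_group)
  interpret \<phi>: group_hom G "G Mod H" "(#>) H"
    by unfold_locales (rule H.r_coset_hom_Mod)
  have zG: "z \<in> carrier G" using z N.subset by blast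
  define conj where "conj x = inv x \<otimes> z \<otimes> x" for x
  have conj_N: "conj x \<in> N" if "x \<in> carrier G" for x
    unfolding conj_def using N.inv_op_closed1[OF that z(1)] by simp
  define T where "T = (\<lambda>x. H #> conj x) ` carrier G"
  have "T \<subseteq> {g \<otimes>\<^bsub>G Mod H\<^esub> (H #> z) \<otimes>\<^bsub>G Mod H\<^esub> inv\<^bsub>G Mod H\<^esub> g | g. g \<in> carrier (G Mod H)}"
  proof
    fix A assume "A \<in> T"
    then obtain x where x: "x \<in> carrier G" "A = H #> conj x" by (auto simp: T_def)
    have "A = (H #> inv x) \<otimes>\<^bsub>G Mod H\<^esub> (H #> z) \<otimes>\<^bsub>G Mod H\<^esub> inv\<^bsub>G Mod H\<^esub> (H #> inv x)"
      using x zG by (simp add: conj_def \<phi>.hom_mult[symmetric] \<phi>.hom_inv[symmetric]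
          del: mult_FactGroup \<phi>.hom_mult \<phi>.hom_inv)
    then show "A \<in> {g \<otimes>\<^bsub>G Mod H\<^esub> (H #> z) \<otimes>\<^bsub>G Mod H\<^esub> inv\<^bsub>G Mod H\<^esub> g | g. g \<in> carrier (G Mod H)}"
      using \<phi>.hom_closed[of "inv x"] x(1) by blast
  qed
  then have "finite T"
    using z(2) unfolding FC_step_def FC_centre_def by (blast intro: finite_subset)
  have "\<forall>A\<in>T. \<exists>x. x \<in> carrier G \<and> A = H #> conj x" by (auto simp: T_def)
  then obtain r where r: "\<And>A. A \<in> T \<Longrightarrow> r A \<in> carrier G" "\<And>A. A \<in> T \<Longrightarrow> A = H #> conj (r A)"
    by metis
  define R where "R = (\<lambda>A. conj (r A)) ` T"
  have "\<exists>k\<in>N \<inter> H. \<exists>c\<in>R. z \<otimes> x = k \<otimes> x \<otimes> c" if x: "x \<in> carrier G" for x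
  proof -
    have A: "H #> conj x \<in> T" using x by (simp add: T_def)
    define c where "c = conj (r (H #> conj x))"
    have c: "c \<in> R" "c \<in> N" "H #> c = H #> conj x"
      using A r[OF A] conj_N[OF r(1)[OF A]] by (auto simp: c_def R_def)
    have cG: "c \<in> carrier G" and conjG: "conj x \<in> carrier G"
      using c(2) conj_N[OF x] N.subset by auto
    have "conj x \<in> H #> c" unfolding c(3) by (rule rcos_self[OF conjG H.subgroup_axioms])
    then obtain h where h: "h \<in> H" "conj x = h \<otimes> c" by (auto simp: r_coset_def)
    have hG: "h \<in> carrier G" using h(1) H.subset by blast
    have "h = conj x \<otimes> inv c" using h(2) hG cG by (simp add: m_assoc)
    then have hN: "h \<in> N" using conj_N[OF x] c(2) by simp
    have "z \<otimes> x = x \<otimes> conj x" using x zG by (simp add: conj_def m_assoc[symmetric])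
    also have "\<dots> = (x \<otimes> h \<otimes> inv x) \<otimes> x \<otimes> c"
      unfolding h(2) using x hG cG by (simp add: m_assoc inv_solve_left)
    finally show ?thesis
      using c(1) N.inv_op_closed2[OF x hN] H.inv_op_closed2[OF x h(1)] by blast
  qed
  moreover have "finite R" "R \<subseteq> N" using \<open>finite T\<close> r(1) conj_N by (auto simp: R_def)
  ultimately show ?thesis by blast
qed

text \<open>
  Transfinite induction along the series. The assumption that \<open>P\<close> charges every element of \<open>N\<close> is what
  allows the conjugates of \<open>z\<close> to serve as steps of the random walk.
\<close>

lemma bounded_harmonic_FC_series_invariant:
  assumes P: "set_pmf P \<subseteq> carrier G" and N: "N \<lhd> G" "N \<subseteq> set_pmf P"
    and bdd: "bounded (f ` carrier G)" and harm: "harmonic G P f"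
    and r: "Well_order r" "i \<in> Field r"
    and z: "z \<in> N" "z \<in> FC_series G r i" and x: "x \<in> carrier G"
  shows "f (z \<otimes> x) = f x"
proof -
  have W: "wo_rel r" using r(1) by (simp add: wo_rel_def)
  have N_sub: "N \<subseteq> carrier G" using N(2) P by blast
  have "i \<in> Field r \<longrightarrow> (\<forall>z\<in>N \<inter> FC_series G r i. \<forall>x\<in>carrier G. f (z \<otimes> x) = f x)"
  proof (induction i rule: wo_rel.well_order_induct[OF W])
    case (1 i)
    have IH: "f (k \<otimes> x) = f x"
      if "j \<in> underS r i" "k \<in> N \<inter> FC_series G r j" "x \<in> carrier G" for j k x
      using 1 that by (auto simp: underS_def Field_def)
    consider (zero) "underS r i = {}" | (succ) j where "is_succ_of r i j"
      | (limit) "underS r i \<noteq> {}" "\<nexists>j. is_succ_of r i j" by blast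
    then show ?case
    proof cases
      case zero
      then show ?thesis using FC_series_zero[OF r(1) zero, of G] by simp
    next
      case (succ j)
      let ?H = "FC_series G r j"
      have j: "j \<in> underS r i" using succ unfolding is_succ_of_def by (rule conjunct1)
      then have H: "?H \<lhd> G"
        using FC_series_normal_mono[OF is_group r(1), of j] by (auto simp: underS_def Field_def)
      have "f (z \<otimes> x) = f x" if z: "z \<in> N" "z \<in> FC_step G ?H" and x: "x \<in> carrier G" for z x
      proof -
        obtain R where R: "finite R" "R \<subseteq> N"
          "\<And>x. x \<in> carrier G \<Longrightarrow> \<exists>k\<in>N \<inter> ?H. \<exists>c\<in>R. z \<otimes> x = k \<otimes> x \<otimes> c"
          using FC_step_conjugates[OF H N(1) z] by blast
        show ?thesis
          by (rule bounded_harmonic_eq_translate[OF P bdd harm _ _ IH[OF j] R(1) _ R(3) x])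
            (use z(1) N_sub R(2) N(2) in auto)
      qed
      then show ?thesis unfolding FC_series_succ[OF r(1) succ, of G] by blast
    next
      case limit
      then show ?thesis using FC_series_limit[OF r(1) limit, of G] IH by auto
    qed
  qed
  then show ?thesis using r(2) z x by blast
qed

lemma bounded_harmonic_FC_hypercentre_invariant:
  assumes "set_pmf P \<subseteq> carrier G" "N \<lhd> G" "N \<subseteq> set_pmf P" "N \<subseteq> FC_hypercentre G"
    and "bounded (f ` carrier G)" "harmonic G P f" "z \<in> N" "x \<in> carrier G"
  shows "f (z \<otimes> x) = f x"
proof -
  obtain i where "z \<in> FC_series G (card_of (UNIV :: 'a set set)) i"
    using assms(4,7) unfolding FC_hypercentre_def by blast
  then show ?thesis
    by (intro bounded_harmonic_FC_series_invariant[OF assms(1-3,5,6) card_of_Well_order _ assms(7)])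
      (use assms(8) in auto)
qed


section \<open>Lazy versions and push-forwards\<close>

text \<open>
  Convolving with the identity mass does nothing, so the defect \<open>f * P - f\<close> is \<open>1 - t\<close> times the
  defect \<open>f * Q - f\<close>, and \<open>1 - t\<close> is nonzero.
\<close>

lemma harmonic_lazy_version_iff:
  assumes lazy: "lazy_version G P Q" and bdd: "bounded (f ` carrier G)"
  shows "harmonic G P f \<longleftrightarrow> harmonic G Q f"
proof -
  obtain t where t: "t < 1" "\<And>x. pmf P x = t * pmf (return_pmf \<one>) x + (1 - t) * pmf Q x"
    using lazy by (auto simp: lazy_version_def)
  have "convolution G f P x = f x \<longleftrightarrow> convolution G f Q x = f x" if x: "x \<in> carrier G" for x
  proof -
    let ?s = "\<lambda>P y. f (x \<otimes> inv y) * pmf P y"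
    have "convolution G f P x =
        (\<Sum>\<^sub>\<infinity>y\<in>carrier G. t * ?s (return_pmf \<one>) y + (1 - t) * ?s Q y)"
      unfolding convolution_def t(2) by (rule infsum_cong) (simp add: algebra_simps)
    also have "\<dots> = t * convolution G f (return_pmf \<one>) x + (1 - t) * convolution G f Q x"
      unfolding convolution_def infsum_cmult_right'[symmetric]
      by (intro infsum_add summable_on_cmult_right convolution_summable[OF bdd x])
    also have "convolution G f (return_pmf \<one>) x = f x"
      using x bdd by (simp add: convolution_eq_expectation)
    finally have "convolution G f P x - f x = (1 - t) * (convolution G f Q x - f x)"
      by (simp add: algebra_simps)
    then show ?thesis using t(1) by (metis diff_gt_0_iff_gt eq_iff_diff_eq_0 less_irrefl mult_eq_0_iff)
  qed
  then show ?thesis by (auto simp: harmonic_def)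
qed

lemma liouville_lazy_version_iff:
  assumes "lazy_version G P Q"
  shows "liouville G P \<longleftrightarrow> liouville G Q"
  using harmonic_lazy_version_iff[OF assms] unfolding liouville_def by blast

end

lemma (in group_hom) harmonic_map_pmf_iff:
  assumes surj: "h ` carrier G = carrier H" and P: "set_pmf P \<subseteq> carrier G"
    and bdd: "bounded (F ` carrier H)"
  shows "harmonic H (map_pmf h P) F \<longleftrightarrow> harmonic G P (\<lambda>x. F (h x))"
proof -
  have bdd': "bounded ((\<lambda>x. F (h x)) ` carrier G)"
    by (rule bounded_subset[OF bdd]) auto
  have "convolution H F (map_pmf h P) (h x) = convolution G (\<lambda>x. F (h x)) P x"
    if x: "x \<in> carrier G" for x
  proof -
    have "convolution H F (map_pmf h P) (h x)
        = measure_pmf.expectation P (\<lambda>y. F (h x \<otimes>\<^bsub>H\<^esub> inv\<^bsub>H\<^esub> h y))"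
      using P x bdd by (subst H.convolution_eq_expectation) auto
    also have "\<dots> = measure_pmf.expectation P (\<lambda>y. F (h (x \<otimes> inv y)))"
      using P x by (intro integral_cong_AE) (auto simp: AE_measure_pmf_iff subset_iff)
    also have "\<dots> = convolution G (\<lambda>x. F (h x)) P x"
      using P x bdd' by (simp add: G.convolution_eq_expectation)
    finally show ?thesis .
  qed
  then show ?thesis unfolding harmonic_def surj[symmetric] by simp
qed

text \<open>
  Functions on \<open>H\<close> are the same as functions on \<open>G\<close> that are constant on the fibres of \<open>h\<close>, and this
  correspondence respects harmonicity. The invariance hypothesis makes all bounded harmonic functions
  on \<open>G\<close> arise in this way.
\<close>

lemma (in group_hom) liouville_map_pmf_iff:
  assumes surj: "h ` carrier G = carrier H" and P: "set_pmf P \<subseteq> carrier G"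
    and inv: "\<And>f z x. bounded (f ` carrier G) \<Longrightarrow> harmonic G P f \<Longrightarrow> z \<in> kernel G H h
      \<Longrightarrow> x \<in> carrier G \<Longrightarrow> f (z \<otimes> x) = f x"
  shows "liouville G P \<longleftrightarrow> liouville H (map_pmf h P)"
proof
  assume L: "liouville G P"
  show "liouville H (map_pmf h P)"
    unfolding liouville_def
  proof (intro allI impI)
    fix F :: "_ \<Rightarrow> real" assume F: "bounded (F ` carrier H)" "harmonic H (map_pmf h P) F"
    have "bounded ((\<lambda>x. F (h x)) ` carrier G)"
      by (rule bounded_subset[OF F(1)]) auto
    moreover have "harmonic G P (\<lambda>x. F (h x))"
      using F harmonic_map_pmf_iff[OF surj P] by blast
    ultimately obtain c where "\<forall>x\<in>carrier G. F (h x) = c"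
      using L[unfolded liouville_def, rule_format] by blast
    then show "\<exists>c. \<forall>x\<in>carrier H. F x = c" unfolding surj[symmetric] by blast
  qed
next
  assume L: "liouville H (map_pmf h P)"
  show "liouville G P"
    unfolding liouville_def
  proof (intro allI impI)
    fix f :: "'a \<Rightarrow> real" assume f: "bounded (f ` carrier G)" "harmonic G P f"
    define F where "F A = f (inv_into (carrier G) h A)" for A
    have F: "F (h x) = f x" if x: "x \<in> carrier G" for x
    proof -
      define y where "y = inv_into (carrier G) h (h x)"
      have y: "y \<in> carrier G" "h y = h x"
        using x by (auto simp: y_def inv_into_into f_inv_into_f)
      have "y \<otimes> inv x \<in> kernel G H h" using x y by (simp add: kernel_def)
      from inv[OF f this x] have "f (y \<otimes> inv x \<otimes> x) = f x" .
      moreover have "y \<otimes> inv x \<otimes> x = y"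
        using x y(1) by (simp only: G.m_assoc G.inv_closed G.l_inv G.r_one)
      ultimately show ?thesis by (simp only: F_def y_def)
    qed
    have "bounded (F ` carrier H)"
      by (rule bounded_subset[OF f(1)]) (auto simp: surj[symmetric] F)
    moreover from this have "harmonic H (map_pmf h P) F"
      using f(2) G.harmonic_cong[of "\<lambda>x. F (h x)" f P] F
      by (simp only: harmonic_map_pmf_iff[OF surj P])
    ultimately obtain c where "\<forall>x\<in>carrier H. F x = c"
      using L[unfolded liouville_def, rule_format] by blast
    then have "\<forall>x\<in>carrier G. f x = c" using F surj by auto
    then show "\<exists>c. \<forall>x\<in>carrier G. f x = c" by blast
  qed
qed

text \<open>
  The first half of the mixture is a geometric distribution transported along an enumeration of \<open>N\<close>,
  to have every element of \<open>N\<close> charged; the second half transports \<open>\<nu>\<close> along a section \<open>s\<close> of the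
  quotient map.
\<close>

lemma (in group) lazy_lift_exists:
  assumes N: "N \<lhd> G" "countable N" and \<nu>: "set_pmf \<nu> \<subseteq> carrier (G Mod N)"
  shows "\<exists>\<mu>. set_pmf \<mu> \<subseteq> carrier G \<and> N \<subseteq> set_pmf \<mu> \<and>
    lazy_version (G Mod N) (map_pmf (\<lambda>x. N #>\<^bsub>G\<^esub> x) \<mu>) \<nu>"
proof -
  interpret normal N G by fact
  define \<eta> where "\<eta> = map_pmf (from_nat_into N) (geometric_pmf (1 / 2))"
  have "N \<noteq> {}" using subgroup.one_closed[OF subgroup_axioms] by blast
  then have \<eta>: "set_pmf \<eta> = N"
    using N(2) by (simp add: \<eta>_def set_pmf_geometric)
  have "\<forall>A\<in>carrier (G Mod N). \<exists>x. x \<in> carrier G \<and> N #> x = A"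
    by (auto simp: FactGroup_def RCOSETS_def)
  then obtain s where s: "\<And>A. A \<in> carrier (G Mod N) \<Longrightarrow> s A \<in> carrier G"
    "\<And>A. A \<in> carrier (G Mod N) \<Longrightarrow> N #> s A = A" by metis
  define \<mu> where "\<mu> = bind_pmf (bernoulli_pmf (1 / 2)) (\<lambda>b. if b then \<eta> else map_pmf s \<nu>)"
  have set_\<mu>: "set_pmf \<mu> = N \<union> s ` set_pmf \<nu>"
    by (auto simp: \<mu>_def \<eta> split: if_splits)
  have "map_pmf (\<lambda>x. N #> x) \<eta> = map_pmf (\<lambda>_. \<one>\<^bsub>G Mod N\<^esub>) \<eta>"
    by (rule map_pmf_cong) (simp_all only: \<eta> one_FactGroup rcos_const[OF is_group])
  then have push_\<eta>: "map_pmf (\<lambda>x. N #> x) \<eta> = return_pmf \<one>\<^bsub>G Mod N\<^esub>"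
    by (simp add: map_pmf_const)
  have "map_pmf (\<lambda>x. N #> x) (map_pmf s \<nu>) = map_pmf id \<nu>"
    unfolding pmf.map_comp by (rule map_pmf_cong) (simp_all only: comp_apply id_apply s(2)[OF subsetD[OF \<nu>]])
  then have push_s: "map_pmf (\<lambda>x. N #> x) (map_pmf s \<nu>) = \<nu>" by (simp only: pmf.map_id)
  have "map_pmf (\<lambda>x. N #> x) \<mu> =
      bind_pmf (bernoulli_pmf (1 / 2)) (\<lambda>b. if b then return_pmf \<one>\<^bsub>G Mod N\<^esub> else \<nu>)"
    unfolding \<mu>_def map_bind_pmf by (rule bind_pmf_cong) (simp_all add: push_\<eta> push_s)
  then have "pmf (map_pmf (\<lambda>x. N #> x) \<mu>) A
      = 1 / 2 * pmf (return_pmf \<one>\<^bsub>G Mod N\<^esub>) A + (1 - 1 / 2) * pmf \<nu> A" for A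
    by (simp add: pmf_bind)
  then have "lazy_version (G Mod N) (map_pmf (\<lambda>x. N #> x) \<mu>) \<nu>"
    unfolding lazy_version_def by (intro exI[of _ "1 / 2"]) simp
  moreover have "set_pmf \<mu> \<subseteq> carrier G" 
    unfolding set_\<mu> using subset s(1)[OF subsetD[OF \<nu>]] by blast
  ultimately show ?thesis using set_\<mu> by blast
qed


section \<open>The Liouville property and hyper-FC-central quotients\<close>

theorem theorem1p1:
  fixes \<Gamma> :: "('a, 'm) monoid_scheme"
    and N :: "'a set"
    and \<nu> :: "'a set pmf"
  assumes "group \<Gamma>"
    and "countable (carrier \<Gamma>)"
    and "N \<lhd> \<Gamma>"
    and "N \<subseteq> FC_hypercentre \<Gamma>"
    and "set_pmf \<nu> \<subseteq> carrier (\<Gamma> Mod N)"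
    and "generate (\<Gamma> Mod N) (set_pmf \<nu>) = carrier (\<Gamma> Mod N)"
  shows "\<exists>\<mu> :: 'a pmf. set_pmf \<mu> \<subseteq> carrier \<Gamma>
           \<and> lazy_version (\<Gamma> Mod N) (map_pmf (\<lambda>x. N #>\<^bsub>\<Gamma>\<^esub> x) \<mu>) \<nu>
           \<and> (liouville \<Gamma> \<mu> \<longleftrightarrow> liouville (\<Gamma> Mod N) \<nu>)"
proof -
  interpret normal N \<Gamma> by fact
  interpret Q: group "\<Gamma> Mod N" by (rule factorgroup_is_group)
  interpret \<phi>: group_hom \<Gamma> "\<Gamma> Mod N" "(#>\<^bsub>\<Gamma>\<^esub>) N"
    by unfold_locales (rule r_coset_hom_Mod)
  have "countable N" using subset assms(2) by (rule countable_subset)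
  then obtain \<mu> where \<mu>: "set_pmf \<mu> \<subseteq> carrier \<Gamma>" "N \<subseteq> set_pmf \<mu>"
    "lazy_version (\<Gamma> Mod N) (map_pmf (\<lambda>x. N #>\<^bsub>\<Gamma>\<^esub> x) \<mu>) \<nu>"
    using lazy_lift_exists[OF assms(3) _ assms(5)] by blast
  have surj: "(#>\<^bsub>\<Gamma>\<^esub>) N ` carrier \<Gamma> = carrier (\<Gamma> Mod N)"
    by (auto simp: FactGroup_def RCOSETS_def)
  have kernel: "kernel \<Gamma> (\<Gamma> Mod N) ((#>\<^bsub>\<Gamma>\<^esub>) N) = N"
  proof
    show "N \<subseteq> kernel \<Gamma> (\<Gamma> Mod N) ((#>\<^bsub>\<Gamma>\<^esub>) N)"
      unfolding kernel_def one_FactGroup using subset rcos_const[OF is_group] by blast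
    show "kernel \<Gamma> (\<Gamma> Mod N) ((#>\<^bsub>\<Gamma>\<^esub>) N) \<subseteq> N"
    proof
      fix x assume "x \<in> kernel \<Gamma> (\<Gamma> Mod N) ((#>\<^bsub>\<Gamma>\<^esub>) N)"
      then have x: "x \<in> carrier \<Gamma>" "N #>\<^bsub>\<Gamma>\<^esub> x = N"
        unfolding kernel_def one_FactGroup by blast+
      then show "x \<in> N" using group.rcos_self[OF is_group x(1) subgroup_axioms] by (simp only:)
    qed
  qed
  have "liouville \<Gamma> \<mu> \<longleftrightarrow> liouville (\<Gamma> Mod N) (map_pmf (\<lambda>x. N #>\<^bsub>\<Gamma>\<^esub> x) \<mu>)"
    by (rule \<phi>.liouville_map_pmf_iff[OF surj \<mu>(1)], unfold kernel)
      (rule bounded_harmonic_FC_hypercentre_invariant[OF \<mu>(1) assms(3) \<mu>(2) assms(4)])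
  also have "\<dots> \<longleftrightarrow> liouville (\<Gamma> Mod N) \<nu>"
    by (rule Q.liouville_lazy_version_iff[OF \<mu>(3)])
  finally show ?thesis using \<mu>(1,3) by (intro exI[of _ \<mu>] conjI)
qed

end
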